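(* Let $A\in\mathbb{R}^{m\times n}$, $m\ge n$, and let $S\in\mathbb{R}^{s\times m}$ be a randomized $(\varepsilon,\delta,\mathrm{rank}(A))$-subspace embedding for $\mathrm{Range}(A)$. Let $A=W\Theta V^{\top}$ be the $S^{\top}S$-SVD of $A$, and let $P=WV^{\top}$ be the solution of $$\min_{\substack{Q\in\mathbb{R}^{m\times n}\\ Q^{\top}S^{\top}SQ=I}}\|A-Q\|_{S,2}.$$ Let $T$ solve $$\min_{\substack{Q\in\mathbb{R}^{m\times n}\\ Q^{\top}Q=I}}\|A-Q\|_2 .$$ Then, with high probability, $$\|A-T\|_2-\frac{\varepsilon}{1-\varepsilon}\le\|A-P\|_2\le\frac{1+\varepsilon}{1-\varepsilon}\|A-T\|_2+\frac{\varepsilon}{1-\varepsilon}.$$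
   Context: Subspace embedding: let $\mathcal{V}$ be a $k$-dimensional subspace of $\mathbb{R}^m$, $\varepsilon\in(0,1)$ and $s\le m$. A (random) linear map $S\in\mathbb{R}^{s\times m}$ is an $(\varepsilon,\delta,k)$-subspace embedding for $\mathcal{V}$ if $(1-\varepsilon)\|v\|^2\le\|Sv\|^2\le(1+\varepsilon)\|v\|^2$ for all $v\in\mathcal{V}$ holds with probability at least $1-\delta$ (Euclidean norms). Norms: $\|\cdot\|_2$ is the spectral norm; for a matrix $B$, $\|B\|_{S,2}^2=\max_{\|x\|_2=1}x^{\top}B^{\top}S^{\top}SBx$, defined under the assumption that $S$ is a subspace embedding for $\mathrm{Range}(B)$. In particular $S$ is assumed to act as an $\varepsilon$-subspace embedding on the ranges of the matrices involved ($A$, $P$, $T$, $A-P$, $A-T$), and "with high probability" refers to the event that the embedding inequality holds on these subspaces. The $S^{\top}S$-SVD of $A$ is the factorization $A=W\Theta V^{\top}$ (holding with probability $1-\delta$), with $W\in\mathbb{R}^{m\times n}$ satisfying $W^{\top}S^{\top}SW=I$, $V\in\mathbb{R}^{n\times n}$ satisfying $V^{\top}V=I$, and $\Theta=\mathrm{diag}(\theta_1,\ldots,\theta_n)$, $\theta_1\ge\ldots\ge\theta_n\ge0$. *)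

theory Defs
  imports "HOL-Probability.Probability"
begin

(* norm on real^'n^'m is the Frobenius norm, hence the explicit operator norm. *)
definition spectral_norm :: "real^'n^'m \<Rightarrow> real" where
  "spectral_norm B = onorm ((*v) B)"

abbreviation mat_range :: "real^'n^'m \<Rightarrow> (real^'m) set" where
  "mat_range B \<equiv> range ((*v) B)"

(* The supremum is attained (continuous function on a compact nonempty sphere), so it is the
   maximum of the quadratic form. *)
definition sketched_norm :: "real^'m^'s \<Rightarrow> real^'n^'m \<Rightarrow> real" where
  "sketched_norm S B =
     sqrt (SUP x\<in>{x. norm x = 1}. x \<bullet> ((transpose B ** transpose S ** S ** B) *v x))"

definition eps_embeds :: "real \<Rightarrow> real^'m^'s \<Rightarrow> (real^'m) set \<Rightarrow> bool" where
  "eps_embeds \<epsilon> S U \<longleftrightarrow>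
     (\<forall>v\<in>U. (1 - \<epsilon>) * (norm v)\<^sup>2 \<le> (norm (S *v v))\<^sup>2 \<and>
             (norm (S *v v))\<^sup>2 \<le> (1 + \<epsilon>) * (norm v)\<^sup>2)"

(* Phrased through an inner event so that it is also meaningful for statements about random
   objects, such as SVD factors, whose measurability is not assumed; for a measurable event it
   says that its probability is at least p. *)
definition holds_with_prob_ge :: "'w measure \<Rightarrow> real \<Rightarrow> ('w \<Rightarrow> bool) \<Rightarrow> bool" where
  "holds_with_prob_ge M p \<Phi> \<longleftrightarrow>
     (\<exists>E\<in>sets M. p \<le> measure M E \<and> (\<forall>\<omega>\<in>E. \<Phi> \<omega>))"

definition random_subspace_embedding ::
  "'w measure \<Rightarrow> real \<Rightarrow> real \<Rightarrow> nat \<Rightarrow> (real^'m) set \<Rightarrow> ('w \<Rightarrow> real^'m^'s) \<Rightarrow> bool" where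
  "random_subspace_embedding M \<epsilon> \<delta> k U S \<longleftrightarrow>
     subspace U \<and> dim U = k \<and> 0 < \<epsilon> \<and> \<epsilon> < 1 \<and> CARD('s) \<le> CARD('m) \<and>
     S \<in> borel_measurable M \<and>
     holds_with_prob_ge M (1 - \<delta>) (\<lambda>\<omega>. eps_embeds \<epsilon> (S \<omega>) U)"

definition diag_mat :: "real^'n \<Rightarrow> real^'n^'n" where
  "diag_mat \<theta> = (\<chi> i j. if i = j then \<theta> $ i else 0)"

(* The S^T S-SVD A = W diag(theta) V^T; the linear order on the column index type 'n plays the
   role of the order 1 < ... < n. *)
definition is_sketched_SVD ::
  "real^'m^'s \<Rightarrow> real^'n::{finite,linorder}^'m \<Rightarrow> real^'n::{finite,linorder}^'m \<Rightarrow>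
     real^'n::{finite,linorder} \<Rightarrow> real^'n::{finite,linorder}^'n::{finite,linorder} \<Rightarrow> bool" where
  "is_sketched_SVD S A W \<theta> V \<longleftrightarrow>
     A = W ** diag_mat \<theta> ** transpose V \<and>
     transpose W ** transpose S ** S ** W = mat 1 \<and>
     transpose V ** V = mat 1 \<and>
     (\<forall>i j. i \<le> j \<longrightarrow> \<theta> $ j \<le> \<theta> $ i) \<and> (\<forall>i. 0 \<le> \<theta> $ i)"

(* S acts as an epsilon-embedding on all subspaces involved in comparing A, P and T. *)
definition embeds_involved_ranges ::
  "real \<Rightarrow> real^'m^'s \<Rightarrow> real^'n^'m \<Rightarrow> real^'n^'m \<Rightarrow> real^'n^'m \<Rightarrow> bool" where
  "embeds_involved_ranges \<epsilon> S A P T \<longleftrightarrow>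
     (\<forall>B\<in>{A, P, T, A - P, A - T}. eps_embeds \<epsilon> S (mat_range B))"

end

theory Submission
  imports Defs
begin

text \<open>
  Each of the two minimisers is nearly feasible for the problem that the other one solves, and a
  nearly feasible matrix can be made feasible at a cost controlled by its defect. The quantitative
  form of this is the lemma \<open>nearby_matrix_with_orthonormal_columns\<close>: if \<open>X\<close> is injective and
  \<open>\<bar>\<parallel>X x\<parallel>\<^sup>2 - \<parallel>x\<parallel>\<^sup>2\<bar> \<le> \<eta> \<parallel>x\<parallel>\<^sup>2\<close> for all \<open>x\<close>, then for a suitable square matrix \<open>G\<close> the matrix
  \<open>X G\<close> has orthonormal columns and lies within spectral distance \<open>\<eta>\<close> of \<open>X\<close>. Here \<open>X G\<close> is the
  polar factor of \<open>X\<close>, obtained from a basis of right singular vectors by replacing each singular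
  value \<open>\<sigma>\<close> by \<open>1\<close>; the estimate holds because \<open>\<bar>\<sigma> - 1\<bar> \<le> \<bar>\<sigma>\<^sup>2 - 1\<bar>\<close>.

  For the lower bound, \<open>\<parallel>S P x\<parallel> = \<parallel>x\<parallel>\<close> and the embedding property give
  \<open>\<parallel>x\<parallel>\<^sup>2 / (1 + \<epsilon>) \<le> \<parallel>P x\<parallel>\<^sup>2 \<le> \<parallel>x\<parallel>\<^sup>2 / (1 - \<epsilon>)\<close>, so that \<open>X = P\<close> is admissible with
  \<open>\<eta> = \<epsilon> / (1 - \<epsilon>)\<close>. Its polar factor \<open>Q\<close> competes with \<open>T\<close>, whence
  \<open>\<parallel>A - T\<parallel> \<le> \<parallel>A - Q\<parallel> \<le> \<parallel>A - P\<parallel> + \<eta>\<close>.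

  For the upper bound, take \<open>X = S T\<close>, which is admissible with \<open>\<eta> = \<epsilon>\<close>. Since \<open>X G = S (T G)\<close>,
  the matrix \<open>T G\<close> competes with \<open>P\<close> in the sketched problem. The sketched norm of \<open>B\<close> is the
  spectral norm of \<open>S B\<close>, and passing from \<open>A - P\<close> to \<open>S (A - P)\<close> and from \<open>S (A - T)\<close> to
  \<open>A - T\<close> by the embedding property yields
  \<open>\<parallel>A - P\<parallel> \<le> (\<surd>(1 + \<epsilon>) \<parallel>A - T\<parallel> + \<epsilon>) / \<surd>(1 - \<epsilon>)\<close>, which is slightly stronger than the claim.
\<close>

section \<open>Right singular vectors\<close>

text \<open>
  A unit vector \<open>b\<close> of \<open>U\<close> that maximises \<open>\<parallel>f b\<parallel>\<close> is a first singular vector: if \<open>x \<in> U\<close> is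
  orthogonal to \<open>b\<close>, then \<open>\<parallel>f (b + t x)\<parallel>\<^sup>2 \<le> \<parallel>f b\<parallel>\<^sup>2 (1 + t\<^sup>2 \<parallel>x\<parallel>\<^sup>2)\<close> for every \<open>t\<close>, and
  the term linear in \<open>t\<close>, which is \<open>2 t (f b \<bullet> f x)\<close>, must vanish.
\<close>

lemma orthogonal_to_maximal_stretch:
  fixes f :: "'a::euclidean_space \<Rightarrow> 'b::euclidean_space"
  assumes f: "linear f" and U: "subspace U"
    and b: "b \<in> U" "norm b = 1"
    and max: "\<And>y. y \<in> U \<Longrightarrow> norm y = 1 \<Longrightarrow> norm (f y) \<le> norm (f b)"
    and x: "x \<in> U" "b \<bullet> x = 0"
  shows "f b \<bullet> f x = 0"
proof -
  have stretch: "(norm (f y))\<^sup>2 \<le> (norm (f b))\<^sup>2 * (norm y)\<^sup>2" if "y \<in> U" for y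
  proof (cases "y = 0")
    case True
    then show ?thesis by (simp add: linear_0[OF f])
  next
    case False
    have "norm (f ((1 / norm y) *\<^sub>R y)) \<le> norm (f b)"
      using False that U by (intro max) (auto intro: subspace_scale)
    then have "norm (f y) \<le> norm (f b) * norm y"
      using False by (simp add: linear_scale[OF f] field_simps)
    then have "(norm (f y))\<^sup>2 \<le> (norm (f b) * norm y)\<^sup>2"
      by (intro power_mono) auto
    then show ?thesis by (simp add: power_mult_distrib)
  qed
  define p where "p = f b \<bullet> f x"
  define c where "c = (norm (f b))\<^sup>2 * (norm x)\<^sup>2"
  have c: "0 \<le> c" by (simp add: c_def)
  have quad: "2 * t * p \<le> t\<^sup>2 * c" for t
  proof -
    have "(norm (f (b + t *\<^sub>R x)))\<^sup>2 = (norm (f b))\<^sup>2 + 2 * t * p + t\<^sup>2 * (norm (f x))\<^sup>2"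
      by (simp add: linear_add[OF f] linear_scale[OF f] power2_norm_eq_inner inner_add_left
          inner_add_right inner_commute[of "f x" "f b"] p_def)
        (simp add: power2_eq_square algebra_simps)
    moreover have "(norm (b + t *\<^sub>R x))\<^sup>2 = 1 + t\<^sup>2 * (norm x)\<^sup>2"
      using b x by (simp add: power2_norm_eq_inner inner_add_left inner_add_right
          inner_commute[of x b] norm_eq_1 power2_eq_square[of t])
    moreover have "b + t *\<^sub>R x \<in> U"
      using b x U by (simp add: subspace_add subspace_scale)
    ultimately have "(norm (f b))\<^sup>2 + 2 * t * p + t\<^sup>2 * (norm (f x))\<^sup>2
        \<le> (norm (f b))\<^sup>2 * (1 + t\<^sup>2 * (norm x)\<^sup>2)"
      using stretch[of "b + t *\<^sub>R x"] by simp
    moreover have "0 \<le> t\<^sup>2 * (norm (f x))\<^sup>2" by simp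
    moreover have "(norm (f b))\<^sup>2 * (1 + t\<^sup>2 * (norm x)\<^sup>2) = (norm (f b))\<^sup>2 + t\<^sup>2 * c"
      by (simp add: c_def algebra_simps)
    ultimately show ?thesis by linarith
  qed
  \<comment> \<open>Evaluated at \<open>t = p / (c + 1)\<close>, the linear term outweighs the quadratic one unless \<open>p = 0\<close>.\<close>
  define t where "t = p / (c + 1)"
  have p: "p = t * (c + 1)" using c by (simp add: t_def)
  have "t\<^sup>2 * (c + 2) \<le> 0"
    using quad[of t] unfolding p by (simp add: power2_eq_square algebra_simps)
  then have "t = 0"
    using c by (simp add: mult_le_0_iff)
  then show ?thesis using p by (simp add: p_def)
qed

text \<open>
  The first basis vector exists by compactness of the unit sphere of \<open>U\<close>, and the others come from
  its orthogonal complement in \<open>U\<close>, by induction on the dimension.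
\<close>

lemma right_singular_basis:
  fixes f :: "'a::euclidean_space \<Rightarrow> 'b::euclidean_space"
  assumes f: "linear f" and "subspace U"
  obtains B where "finite B" "B \<subseteq> U" "span B = U" "pairwise orthogonal B"
    "\<And>b. b \<in> B \<Longrightarrow> norm b = 1" "pairwise (\<lambda>b c. orthogonal (f b) (f c)) B"
proof -
  have "\<exists>B. finite B \<and> B \<subseteq> U \<and> span B = U \<and> pairwise orthogonal B \<and> (\<forall>b\<in>B. norm b = 1) \<and>
      pairwise (\<lambda>b c. orthogonal (f b) (f c)) B"
    using \<open>subspace U\<close>
  proof (induction "dim U" arbitrary: U rule: less_induct)
    case less
    note U = \<open>subspace U\<close>
    show ?case
    proof (cases "U = {0}")
      case True
      then show ?thesis by (intro exI[of _ "{}"]) auto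
    next
      case False
      then obtain u where u: "u \<in> U" "u \<noteq> 0"
        using subspace_0[OF U] by auto
      define K where "K = U \<inter> sphere 0 1"
      have "compact K"
        unfolding K_def by (intro closed_Int_compact closed_subspace U compact_sphere)
      moreover have "(1 / norm u) *\<^sub>R u \<in> K"
        using u U by (auto simp: K_def intro: subspace_scale)
      moreover have "continuous_on K (\<lambda>x. norm (f x))"
        by (intro continuous_on_norm linear_continuous_on linear_conv_bounded_linear[THEN iffD1] f)
      ultimately obtain b where b: "b \<in> K" and max: "\<And>y. y \<in> K \<Longrightarrow> norm (f y) \<le> norm (f b)"
        using continuous_attains_sup[of K "\<lambda>x. norm (f x)"] by blast
      have bU: "b \<in> U" "norm b = 1" using b by (auto simp: K_def)
      have image_orth: "f b \<bullet> f x = 0" if "x \<in> U" "b \<bullet> x = 0" for x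
        using that max by (intro orthogonal_to_maximal_stretch[OF f U bU]) (auto simp: K_def)
      define U' where "U' = U \<inter> {x. b \<bullet> x = 0}"
      have U': "subspace U'"
        unfolding U'_def by (intro subspace_inter U subspace_hyperplane)
      have "b \<notin> U'" using bU by (auto simp: U'_def)
      then have "U' \<subset> U" using bU unfolding U'_def by blast
      then have "dim U' < dim U"
        by (intro dim_psubset) (simp add: span_eq_iff[THEN iffD2] U U')
      from less.hyps[OF this U'] obtain B where B: "finite B" "B \<subseteq> U'" "span B = U'"
        "pairwise orthogonal B" "\<forall>b\<in>B. norm b = 1" "pairwise (\<lambda>b c. orthogonal (f b) (f c)) B"
        by blast
      have "span (insert b B) = U"
      proof
        show "span (insert b B) \<subseteq> U"
          using B bU U by (intro span_minimal) (auto simp: U'_def)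
        show "U \<subseteq> span (insert b B)"
        proof
          fix x assume "x \<in> U"
          then have "x - (b \<bullet> x) *\<^sub>R b \<in> U'"
            using bU U
            by (auto simp: U'_def inner_diff_right norm_eq_1 intro: subspace_diff subspace_scale)
          then have "x - (b \<bullet> x) *\<^sub>R b \<in> span B" using B by simp
          then show "x \<in> span (insert b B)"
            unfolding span_insert by blast
        qed
      qed
      moreover have "pairwise orthogonal (insert b B)"
        using B by (auto simp: pairwise_insert orthogonal_def U'_def inner_commute)
      moreover have "f b \<bullet> f c = 0" "f c \<bullet> f b = 0" if "c \<in> B" for c
        using image_orth[of c] B(2) that by (auto simp: U'_def inner_commute[of "f c"])
      then have "pairwise (\<lambda>b c. orthogonal (f b) (f c)) (insert b B)"
        using B(6) by (simp add: pairwise_insert orthogonal_def)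
      ultimately show ?thesis
        using B bU by (intro exI[of _ "insert b B"]) (auto simp: U'_def)
    qed
  qed
  then show ?thesis using that by blast
qed

section \<open>Orthonormalising a near-isometry\<close>

lemma inner_gram_matrix:
  fixes X :: "real^'n^'m"
  shows "x \<bullet> ((transpose X ** X) *v y) = (X *v x) \<bullet> (X *v y)"
  by (metis dot_lmul_matrix matrix_vector_mul_assoc transpose_matrix_vector transpose_transpose)

lemma orthonormal_columns_iff_isometry:
  fixes X :: "real^'n^'m"
  shows "transpose X ** X = mat 1 \<longleftrightarrow> (\<forall>x. norm (X *v x) = norm x)"
proof
  assume "transpose X ** X = mat 1"
  then show "\<forall>x. norm (X *v x) = norm x"
    by (simp add: norm_eq_sqrt_inner flip: inner_gram_matrix)
next
  assume iso: "\<forall>x. norm (X *v x) = norm x"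
  have "(X *v x) \<bullet> (X *v y) = x \<bullet> y" for x y
    unfolding dot_norm using iso by (metis matrix_vector_right_distrib)
  then have "(transpose X ** X) *v y = mat 1 *v y" for y
    by (intro vector_eq_ldot[THEN iffD1]) (simp add: inner_gram_matrix)
  then show "transpose X ** X = mat 1"
    by (simp add: matrix_eq)
qed

lemma abs_minus_one_le_abs_square_minus_one:
  fixes s :: real
  assumes "0 \<le> s"
  shows "\<bar>s - 1\<bar> \<le> \<bar>s\<^sup>2 - 1\<bar>"
proof -
  have "\<bar>s\<^sup>2 - 1\<bar> = \<bar>s - 1\<bar> * (s + 1)"
    using assms abs_mult[of "s - 1" "s + 1"] by (simp add: power2_eq_square algebra_simps)
  then show ?thesis
    using assms mult_left_mono[of 1 "s + 1" "\<bar>s - 1\<bar>"] by simp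
qed

text \<open>
  With \<open>b\<close> running through the right singular basis \<open>B\<close>, the map \<open>g\<close> divides the coordinate along
  \<open>b\<close> by the singular value \<open>\<parallel>f b\<parallel>\<close>. Then \<open>f \<circ> g\<close> sends \<open>B\<close> to an orthonormal set, and \<open>f - f \<circ> g\<close>
  sends it to orthogonal vectors of length \<open>\<bar>\<parallel>f b\<parallel> - 1\<bar>\<close>; both claims follow from Pythagoras.
\<close>

lemma nearby_isometry:
  fixes f :: "'a::euclidean_space \<Rightarrow> 'b::euclidean_space"
  assumes f: "linear f" and inj: "\<And>x. f x = 0 \<Longrightarrow> x = 0"
    and near: "\<And>x. \<bar>(norm (f x))\<^sup>2 - (norm x)\<^sup>2\<bar> \<le> \<eta> * (norm x)\<^sup>2"
  obtains g where "linear g" "\<And>x. norm (f (g x)) = norm x" "\<And>x. norm (f x - f (g x)) \<le> \<eta> * norm x"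
proof -
  obtain B where B: "finite B" "span B = UNIV" "pairwise orthogonal B"
      "\<And>b. b \<in> B \<Longrightarrow> norm b = 1"
    and fB: "pairwise (\<lambda>b c. orthogonal (f b) (f c)) B"
    using right_singular_basis[OF f subspace_UNIV] by metis
  define g where "g x = (\<Sum>b\<in>B. (x \<bullet> b / norm (f b)) *\<^sub>R b)" for x
  have expand: "(\<Sum>b\<in>B. (x \<bullet> b) *\<^sub>R b) = x" for x
    using B by (intro orthonormal_basis_expand) auto
  have image_norm: "(norm (\<Sum>b\<in>B. a b *\<^sub>R f b))\<^sup>2 = (\<Sum>b\<in>B. (a b)\<^sup>2 * (norm (f b))\<^sup>2)" for a
    using norm_sum_Pythagorean[OF B(1), of "\<lambda>b. a b *\<^sub>R f b"] fB
    by (simp add: pairwise_def orthogonal_def power_mult_distrib)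
  have coords: "(norm x)\<^sup>2 = (\<Sum>b\<in>B. (x \<bullet> b)\<^sup>2)" for x
    using norm_sum_Pythagorean[OF B(1), of "\<lambda>b. (x \<bullet> b) *\<^sub>R b"] B(3,4) expand[of x]
    by (simp add: pairwise_def orthogonal_def power_mult_distrib)
  have fb: "f b \<noteq> 0" if "b \<in> B" for b
    using inj[of b] B(4)[OF that] by auto
  have fg: "f (g x) = (\<Sum>b\<in>B. (x \<bullet> b / norm (f b)) *\<^sub>R f b)" for x
    by (simp add: g_def linear_sum[OF f] linear_scale[OF f])
  have "linear g"
    by (rule linearI)
      (simp_all add: g_def inner_add_left add_divide_distrib scaleR_add_left sum.distrib
        scaleR_sum_right)
  moreover have "norm (f (g x)) = norm x" for x
  proof -
    have "(norm (f (g x)))\<^sup>2 = (norm x)\<^sup>2"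
      unfolding fg image_norm coords by (intro sum.cong) (simp_all add: power_divide fb)
    then show ?thesis by simp
  qed
  moreover have "norm (f x - f (g x)) \<le> \<eta> * norm x" for x
  proof -
    have sv: "\<bar>norm (f b) - 1\<bar> \<le> \<eta>" if "b \<in> B" for b
      using abs_minus_one_le_abs_square_minus_one[of "norm (f b)"] near[of b] B(4)[OF that] by simp
    have "0 \<le> \<eta> * norm x"
    proof (cases "x = 0")
      case False
      have "0 \<le> \<eta> * (norm x)\<^sup>2" using near[of x] by linarith
      then show ?thesis using False by (simp add: zero_le_mult_iff)
    qed simp
    have "f x = (\<Sum>b\<in>B. (x \<bullet> b) *\<^sub>R f b)"
      by (subst expand[of x, symmetric]) (simp add: linear_sum[OF f] linear_scale[OF f])
    then have "f x - f (g x) = (\<Sum>b\<in>B. (x \<bullet> b - x \<bullet> b / norm (f b)) *\<^sub>R f b)"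
      by (simp add: fg scaleR_diff_left sum_subtractf)
    then have "(norm (f x - f (g x)))\<^sup>2
        = (\<Sum>b\<in>B. (x \<bullet> b - x \<bullet> b / norm (f b))\<^sup>2 * (norm (f b))\<^sup>2)"
      by (simp add: image_norm)
    also have "\<dots> = (\<Sum>b\<in>B. (x \<bullet> b)\<^sup>2 * (norm (f b) - 1)\<^sup>2)"
    proof (intro sum.cong refl)
      fix b assume "b \<in> B"
      then have "(x \<bullet> b - x \<bullet> b / norm (f b)) * norm (f b) = (x \<bullet> b) * (norm (f b) - 1)"
        using fb by (simp add: field_simps)
      then show "(x \<bullet> b - x \<bullet> b / norm (f b))\<^sup>2 * (norm (f b))\<^sup>2 = (x \<bullet> b)\<^sup>2 * (norm (f b) - 1)\<^sup>2"
        by (metis power_mult_distrib)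
    qed
    also have "\<dots> \<le> (\<Sum>b\<in>B. (x \<bullet> b)\<^sup>2 * \<eta>\<^sup>2)"
      using order_trans[OF sv abs_ge_self]
      by (intro sum_mono mult_left_mono) (auto simp flip: abs_le_square_iff)
    also have "\<dots> = (\<eta> * norm x)\<^sup>2"
      by (simp add: power_mult_distrib coords sum_distrib_left mult.commute)
    finally show ?thesis
      using \<open>0 \<le> \<eta> * norm x\<close> by (rule power2_le_imp_le)
  qed
  ultimately show ?thesis using that by blast
qed

lemma nearby_matrix_with_orthonormal_columns:
  fixes X :: "real^'n^'m"
  assumes "\<And>x. X *v x = 0 \<Longrightarrow> x = 0"
    and "\<And>x. \<bar>(norm (X *v x))\<^sup>2 - (norm x)\<^sup>2\<bar> \<le> \<eta> * (norm x)\<^sup>2"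
  obtains G where "transpose (X ** G) ** (X ** G) = mat 1" "spectral_norm (X - X ** G) \<le> \<eta>"
proof -
  obtain g where g: "linear g" "\<And>x. norm (X *v g x) = norm x"
      "\<And>x. norm (X *v x - X *v g x) \<le> \<eta> * norm x"
    using nearby_isometry[OF matrix_vector_mul_linear[of X] assms] by blast
  have G: "(X ** matrix g) *v x = X *v g x" for x
    by (simp add: matrix_works g(1) flip: matrix_vector_mul_assoc)
  show ?thesis
  proof
    show "transpose (X ** matrix g) ** (X ** matrix g) = mat 1"
      by (simp add: orthonormal_columns_iff_isometry G g)
    show "spectral_norm (X - X ** matrix g) \<le> \<eta>"
      unfolding spectral_norm_def
      by (intro onorm_le) (simp add: matrix_vector_mult_diff_rdistrib G g)
  qed
qed

section \<open>Spectral and sketched norms\<close>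

lemma norm_matrix_vector_le_spectral_norm:
  fixes B :: "real^'n^'m"
  shows "norm (B *v x) \<le> spectral_norm B * norm x"
  unfolding spectral_norm_def by (intro onorm) simp

lemma spectral_norm_nonneg:
  fixes B :: "real^'n^'m"
  shows "0 \<le> spectral_norm B"
  unfolding spectral_norm_def by (intro onorm_pos_le) simp

lemma spectral_norm_triangle:
  fixes B C :: "real^'n^'m"
  shows "spectral_norm (B + C) \<le> spectral_norm B + spectral_norm C"
  unfolding spectral_norm_def matrix_vector_mult_add_rdistrib by (intro onorm_triangle) simp_all

text \<open>
  The quadratic form under the supremum is \<open>\<parallel>S B x\<parallel>\<^sup>2\<close>, so the sketched norm inherits
  the triangle inequality for operator norms, which splits \<open>A - T G\<close> into \<open>A - T\<close> and \<open>T - T G\<close>.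
\<close>

lemma sketched_norm_eq_spectral_norm:
  fixes S :: "real^'m^'s" and B :: "real^'n^'m"
  shows "sketched_norm S B = spectral_norm (S ** B)"
proof -
  define L where "L = spectral_norm (S ** B)"
  define q where "q x = (norm ((S ** B) *v x))\<^sup>2" for x
  define R where "R = (SUP x\<in>{x. norm x = 1}. q x)"
  have "x \<bullet> ((transpose B ** transpose S ** S ** B) *v x) = q x" for x
    using inner_gram_matrix[of x "S ** B" x]
    by (simp add: q_def power2_norm_eq_inner matrix_transpose_mul matrix_mul_assoc)
  then have R: "sketched_norm S B = sqrt R"
    by (simp add: sketched_norm_def R_def)
  have L: "0 \<le> L" by (simp add: L_def spectral_norm_nonneg)
  have q_le: "q x \<le> L\<^sup>2" if "norm x = 1" for x
    using norm_matrix_vector_le_spectral_norm[of "S ** B" x] that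
    unfolding q_def L_def by (intro power_mono) auto
  obtain e :: "real^'n" where e: "norm e = 1"
    using vector_choose_size[of 1] by auto
  have "R \<le> L\<^sup>2"
    unfolding R_def using e q_le by (intro cSUP_least) auto
  then have "sqrt R \<le> L"
    using L by (simp add: real_le_lsqrt)
  moreover have "L \<le> sqrt R"
    unfolding L_def spectral_norm_def
  proof (rule onorm_le)
    fix x :: "real^'n"
    show "norm ((S ** B) *v x) \<le> sqrt R * norm x"
    proof (cases "x = 0")
      case False
      have "q ((1 / norm x) *\<^sub>R x) \<le> R"
        unfolding R_def using q_le False by (intro cSUP_upper bdd_aboveI2[of _ _ "L\<^sup>2"]) auto
      then have "norm ((S ** B) *v ((1 / norm x) *\<^sub>R x)) \<le> sqrt R"
        unfolding q_def by (rule real_le_rsqrt)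
      then show ?thesis
        using False by (simp add: matrix_vector_mult_scaleR field_simps)
    qed simp
  qed
  ultimately show ?thesis by (simp add: R L_def)
qed

lemma spectral_norm_le_sketched_norm:
  assumes "eps_embeds \<epsilon> S (mat_range B)" and "\<epsilon> < 1"
  shows "spectral_norm B \<le> spectral_norm (S ** B) / sqrt (1 - \<epsilon>)"
  unfolding spectral_norm_def[of B]
proof (rule onorm_le)
  fix x
  have "(1 - \<epsilon>) * (norm (B *v x))\<^sup>2 \<le> (norm ((S ** B) *v x))\<^sup>2"
    using assms by (simp add: eps_embeds_def matrix_vector_mul_assoc)
  then have "sqrt (1 - \<epsilon>) * norm (B *v x) \<le> norm ((S ** B) *v x)"
    using real_sqrt_le_mono by (fastforce simp: real_sqrt_mult)
  also have "\<dots> \<le> spectral_norm (S ** B) * norm x"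
    by (rule norm_matrix_vector_le_spectral_norm)
  finally show "norm (B *v x) \<le> spectral_norm (S ** B) / sqrt (1 - \<epsilon>) * norm x"
    using assms by (simp add: field_simps)
qed

lemma sketched_norm_le_spectral_norm:
  assumes "eps_embeds \<epsilon> S (mat_range B)" and "0 \<le> \<epsilon>"
  shows "spectral_norm (S ** B) \<le> sqrt (1 + \<epsilon>) * spectral_norm B"
  unfolding spectral_norm_def[of "S ** B"]
proof (rule onorm_le)
  fix x
  have "(norm ((S ** B) *v x))\<^sup>2 \<le> (1 + \<epsilon>) * (norm (B *v x))\<^sup>2"
    using assms by (simp add: eps_embeds_def matrix_vector_mul_assoc)
  then have "norm ((S ** B) *v x) \<le> sqrt (1 + \<epsilon>) * norm (B *v x)"
    using real_sqrt_le_mono by (fastforce simp: real_sqrt_mult)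
  also have "\<dots> \<le> sqrt (1 + \<epsilon>) * (spectral_norm B * norm x)"
    using assms by (intro mult_left_mono norm_matrix_vector_le_spectral_norm) auto
  finally show "norm ((S ** B) *v x) \<le> sqrt (1 + \<epsilon>) * spectral_norm B * norm x"
    by simp
qed

section \<open>Comparing the two minimisers\<close>

lemma spectral_minimiser_bound:
  fixes A P T :: "real^'n^'m" and S :: "real^'m^'s"
  assumes \<epsilon>: "0 < \<epsilon>" "\<epsilon> < 1"
    and P: "transpose (S ** P) ** (S ** P) = mat 1"
    and emb: "eps_embeds \<epsilon> S (mat_range P)"
    and T_min: "\<And>Q. transpose Q ** Q = mat 1 \<Longrightarrow> spectral_norm (A - T) \<le> spectral_norm (A - Q)"
  shows "spectral_norm (A - T) \<le> spectral_norm (A - P) + \<epsilon> / (1 - \<epsilon>)"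
proof -
  have embP: "(1 - \<epsilon>) * (norm (P *v x))\<^sup>2 \<le> (norm x)\<^sup>2"
      "(norm x)\<^sup>2 \<le> (1 + \<epsilon>) * (norm (P *v x))\<^sup>2" for x
    using emb P by (auto simp: eps_embeds_def orthonormal_columns_iff_isometry matrix_vector_mul_assoc)
  have "x = 0" if "P *v x = 0" for x
    using embP(2)[of x] that by simp
  moreover have "\<bar>(norm (P *v x))\<^sup>2 - (norm x)\<^sup>2\<bar> \<le> \<epsilon> / (1 - \<epsilon>) * (norm x)\<^sup>2" for x
  proof -
    define u v where "u = (norm (P *v x))\<^sup>2" and "v = (norm x)\<^sup>2"
    have uv: "(1 - \<epsilon>) * u \<le> v" "v \<le> (1 + \<epsilon>) * u" "0 \<le> u"
      using embP[of x] by (auto simp: u_def v_def)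
    have "(1 - \<epsilon>) * (u - v) \<le> \<epsilon> * v"
      using uv by (simp add: algebra_simps)
    \<comment> \<open>Here even \<open>v - u \<le> \<epsilon> / (1 + \<epsilon>) * v\<close>; the larger constant is forced by the case \<open>u > v\<close>.\<close>
    moreover have "(1 - \<epsilon>) * (v - u) \<le> \<epsilon> * v"
    proof -
      have "v - u \<le> \<epsilon> * u" using uv by (simp add: algebra_simps)
      then have "(1 - \<epsilon>) * (v - u) \<le> (1 - \<epsilon>) * (\<epsilon> * u)"
        using \<epsilon> by (intro mult_left_mono) auto
      also have "\<dots> = \<epsilon> * ((1 - \<epsilon>) * u)" by simp
      also have "\<dots> \<le> \<epsilon> * v" using uv \<epsilon> by (intro mult_left_mono) auto
      finally show ?thesis .
    qed
    ultimately have "(1 - \<epsilon>) * \<bar>u - v\<bar> \<le> \<epsilon> * v"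
      by (simp add: abs_if)
    then show ?thesis
      using \<epsilon> by (simp add: u_def[symmetric] v_def[symmetric] field_simps)
  qed
  ultimately obtain G where G: "transpose (P ** G) ** (P ** G) = mat 1"
      "spectral_norm (P - P ** G) \<le> \<epsilon> / (1 - \<epsilon>)"
    by (rule nearby_matrix_with_orthonormal_columns)
  have "spectral_norm (A - T) \<le> spectral_norm ((A - P) + (P - P ** G))"
    using T_min[OF G(1)] by simp
  also have "\<dots> \<le> spectral_norm (A - P) + spectral_norm (P - P ** G)"
    by (rule spectral_norm_triangle)
  finally show ?thesis using G(2) by simp
qed

text \<open>
  The assumption on \<open>P\<close> is minimality in the sketched norm, rewritten as a spectral norm.
  Dividing by \<open>\<surd>(1 - \<epsilon>)\<close> would give a sharper constant; the stated one absorbs it through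
  \<open>1 - \<epsilon> \<le> \<surd>(1 - \<epsilon>)\<close>.
\<close>

lemma sketched_minimiser_bound:
  fixes A P T :: "real^'n^'m" and S :: "real^'m^'s"
  assumes \<epsilon>: "0 < \<epsilon>" "\<epsilon> < 1"
    and T: "transpose T ** T = mat 1"
    and embT: "eps_embeds \<epsilon> S (mat_range T)"
    and embAP: "eps_embeds \<epsilon> S (mat_range (A - P))"
    and embAT: "eps_embeds \<epsilon> S (mat_range (A - T))"
    and P_min: "\<And>Q. transpose (S ** Q) ** (S ** Q) = mat 1 \<Longrightarrow>
      spectral_norm (S ** (A - P)) \<le> spectral_norm (S ** (A - Q))"
  shows "spectral_norm (A - P) \<le> (1 + \<epsilon>) / (1 - \<epsilon>) * spectral_norm (A - T) + \<epsilon> / (1 - \<epsilon>)"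
proof -
  define r where "r = sqrt (1 - \<epsilon>)"
  have r: "0 < r" "1 - \<epsilon> \<le> r"
    using \<epsilon> by (auto simp: r_def intro!: real_le_rsqrt simp: power2_eq_square mult_left_le)
  have "sqrt (1 + \<epsilon>) \<le> 1 + \<epsilon>"
    using \<epsilon> by (intro real_le_lsqrt) (auto simp: power2_eq_square algebra_simps)
  note sqrts = r this
  have embST: "(1 - \<epsilon>) * (norm x)\<^sup>2 \<le> (norm ((S ** T) *v x))\<^sup>2"
      "(norm ((S ** T) *v x))\<^sup>2 \<le> (1 + \<epsilon>) * (norm x)\<^sup>2" for x
    using embT T by (auto simp: eps_embeds_def orthonormal_columns_iff_isometry matrix_vector_mul_assoc)
  have "x = 0" if "(S ** T) *v x = 0" for x
    using embST(1)[of x] that \<epsilon> by (simp add: mult_le_0_iff)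
  moreover have "\<bar>(norm ((S ** T) *v x))\<^sup>2 - (norm x)\<^sup>2\<bar> \<le> \<epsilon> * (norm x)\<^sup>2" for x
    using embST[of x] by (simp add: abs_le_iff algebra_simps)
  ultimately obtain G where G: "transpose (S ** T ** G) ** (S ** T ** G) = mat 1"
      "spectral_norm (S ** T - S ** T ** G) \<le> \<epsilon>"
    by (rule nearby_matrix_with_orthonormal_columns)
  have "spectral_norm (S ** (A - P)) \<le> spectral_norm (S ** (A - T ** G))"
    using G(1) by (intro P_min) (simp add: matrix_mul_assoc)
  also have "S ** (A - T ** G) = S ** (A - T) + (S ** T - S ** T ** G)"
    by (simp add: matrix_eq matrix_vector_mult_add_rdistrib matrix_vector_mult_diff_rdistrib
        matrix_vector_mult_diff_distrib flip: matrix_vector_mul_assoc)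
  also have "spectral_norm \<dots> \<le> spectral_norm (S ** (A - T)) + spectral_norm (S ** T - S ** T ** G)"
    by (rule spectral_norm_triangle)
  also have "\<dots> \<le> sqrt (1 + \<epsilon>) * spectral_norm (A - T) + \<epsilon>"
    using sketched_norm_le_spectral_norm[OF embAT] \<epsilon> G(2) by (intro add_mono) auto
  also have "\<dots> \<le> (1 + \<epsilon>) * spectral_norm (A - T) + \<epsilon>"
    using sqrts spectral_norm_nonneg[of "A - T"] by (intro add_mono mult_right_mono) auto
  finally have num: "spectral_norm (S ** (A - P)) \<le> (1 + \<epsilon>) * spectral_norm (A - T) + \<epsilon>" .
  have "spectral_norm (A - P) \<le> spectral_norm (S ** (A - P)) / r"
    unfolding r_def by (rule spectral_norm_le_sketched_norm[OF embAP \<epsilon>(2)])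
  also have "\<dots> \<le> ((1 + \<epsilon>) * spectral_norm (A - T) + \<epsilon>) / (1 - \<epsilon>)"
    using num sqrts \<epsilon> spectral_norm_nonneg[of "S ** (A - P)"] by (intro frac_le) linarith+
  finally show ?thesis by (simp add: add_divide_distrib[of "(1 + \<epsilon>) * _"])
qed

text \<open>
  Because \<open>V\<close> is square, its orthonormal columns make \<open>V\<^sup>T\<close> an isometry as well.
\<close>

lemma sketched_SVD_orthonormal_polar_factor:
  assumes "is_sketched_SVD S A W \<theta> V"
  shows "transpose (S ** (W ** transpose V)) ** (S ** (W ** transpose V)) = mat 1"
proof -
  have W: "transpose (S ** W) ** (S ** W) = mat 1" and V: "transpose V ** V = mat 1"
    using assms by (simp_all add: is_sketched_SVD_def matrix_transpose_mul matrix_mul_assoc)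
  have "norm (S *v (W *v (transpose V *v x))) = norm x" for x
    using V W matrix_left_right_inverse[of "transpose V" V]
      orthonormal_columns_iff_isometry[of "S ** W"]
      orthonormal_columns_iff_isometry[of "transpose V"]
    by (simp flip: matrix_vector_mul_assoc)
  then show ?thesis
    by (simp add: orthonormal_columns_iff_isometry flip: matrix_vector_mul_assoc)
qed

theorem proposition3:
  fixes M :: "'w measure"
    and S :: "'w \<Rightarrow> real^'m^'s"
    and A T :: "real^'n::{finite,linorder}^'m"
    and W P :: "'w \<Rightarrow> real^'n::{finite,linorder}^'m"
    and \<theta> :: "'w \<Rightarrow> real^'n::{finite,linorder}"
    and V :: "'w \<Rightarrow> real^'n::{finite,linorder}^'n::{finite,linorder}"
    and \<epsilon> \<delta> :: real
  assumes prob: "prob_space M"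
    and dims: "CARD('n::{finite,linorder}) \<le> CARD('m)"
    and S: "random_subspace_embedding M \<epsilon> \<delta> (rank A) (mat_range A) S"
    and svd: "holds_with_prob_ge M (1 - \<delta>) (\<lambda>\<omega>. is_sketched_SVD (S \<omega>) A (W \<omega>) (\<theta> \<omega>) (V \<omega>))"
    and P: "\<And>\<omega>. P \<omega> = W \<omega> ** transpose (V \<omega>)"
    and P_min: "\<And>\<omega>. \<omega> \<in> space M \<Longrightarrow> is_sketched_SVD (S \<omega>) A (W \<omega>) (\<theta> \<omega>) (V \<omega>) \<Longrightarrow>
        is_arg_min (\<lambda>Q. sketched_norm (S \<omega>) (A - Q))
          (\<lambda>Q. transpose Q ** transpose (S \<omega>) ** S \<omega> ** Q = mat 1) (P \<omega>)"
    and T_min: "is_arg_min (\<lambda>Q. spectral_norm (A - Q)) (\<lambda>Q. transpose Q ** Q = mat 1) T"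
  shows "let good = (\<lambda>\<omega>. is_sketched_SVD (S \<omega>) A (W \<omega>) (\<theta> \<omega>) (V \<omega>) \<and>
                       embeds_involved_ranges \<epsilon> (S \<omega>) A (P \<omega>) T);
             bounds = (\<lambda>\<omega>.
               spectral_norm (A - T) - \<epsilon> / (1 - \<epsilon>) \<le> spectral_norm (A - P \<omega>) \<and>
               spectral_norm (A - P \<omega>)
                 \<le> (1 + \<epsilon>) / (1 - \<epsilon>) * spectral_norm (A - T) + \<epsilon> / (1 - \<epsilon>))
         in (\<forall>\<omega>\<in>space M. good \<omega> \<longrightarrow> bounds \<omega>) \<and>
            (\<forall>p. holds_with_prob_ge M p good \<longrightarrow> holds_with_prob_ge M p bounds)"
proof -
  have \<epsilon>: "0 < \<epsilon>" "\<epsilon> < 1"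
    using S by (auto simp: random_subspace_embedding_def)
  have T: "transpose T ** T = mat 1"
    and T_le: "\<And>Q. transpose Q ** Q = mat 1 \<Longrightarrow> spectral_norm (A - T) \<le> spectral_norm (A - Q)"
    using T_min by (auto simp: is_arg_min_linorder)
  have bounds: "spectral_norm (A - T) - \<epsilon> / (1 - \<epsilon>) \<le> spectral_norm (A - P \<omega>) \<and>
      spectral_norm (A - P \<omega>) \<le> (1 + \<epsilon>) / (1 - \<epsilon>) * spectral_norm (A - T) + \<epsilon> / (1 - \<epsilon>)"
    if \<omega>: "\<omega> \<in> space M" and svd_\<omega>: "is_sketched_SVD (S \<omega>) A (W \<omega>) (\<theta> \<omega>) (V \<omega>)"
      and emb: "embeds_involved_ranges \<epsilon> (S \<omega>) A (P \<omega>) T" for \<omega>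
  proof -
    have P_orth: "transpose (S \<omega> ** P \<omega>) ** (S \<omega> ** P \<omega>) = mat 1"
      unfolding P by (rule sketched_SVD_orthonormal_polar_factor[OF svd_\<omega>])
    have P_le: "spectral_norm (S \<omega> ** (A - P \<omega>)) \<le> spectral_norm (S \<omega> ** (A - Q))"
      if "transpose (S \<omega> ** Q) ** (S \<omega> ** Q) = mat 1" for Q
      using P_min[OF \<omega> svd_\<omega>] that
      by (simp add: is_arg_min_linorder sketched_norm_eq_spectral_norm matrix_transpose_mul
          matrix_mul_assoc)
    have "spectral_norm (A - T) \<le> spectral_norm (A - P \<omega>) + \<epsilon> / (1 - \<epsilon>)"
      using emb by (intro spectral_minimiser_bound[OF \<epsilon> P_orth _ T_le])
        (auto simp: embeds_involved_ranges_def)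
    moreover have "spectral_norm (A - P \<omega>)
        \<le> (1 + \<epsilon>) / (1 - \<epsilon>) * spectral_norm (A - T) + \<epsilon> / (1 - \<epsilon>)"
      using emb by (intro sketched_minimiser_bound[OF \<epsilon> T _ _ _ P_le])
        (auto simp: embeds_involved_ranges_def)
    ultimately show ?thesis by simp
  qed
  show ?thesis
    unfolding Let_def holds_with_prob_ge_def
    using bounds sets.sets_into_space by (meson subsetD)
qed

end
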